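(* Let $\mathcal{U}$ be the smallest family of sets of strings over $\{0,1,2,3\}$ such that (1) the two $1$-dimensional USOs $\{0,2\}$ and $\{1,3\}$ belong to $\mathcal{U}$; and (2) whenever $d\ge 1$ and $i\ge 1$, $\left(S^{(0)}_{1,\ldots,i},S^{(1)}_{1,\ldots,i},S^{(2)}_{1,\ldots,i},S^{(3)}_{1,\ldots,i}\right)$ is a generalized rewriting rule with $S^{(m)}_j\subseteq\{0,1,2,3\}^d$, each $S^{(m)}_j$ is a partial orientation of an already obtained USO (that is, for all $m\in\{0,1,2,3\}$ and $j\in[i]$ there is some $U\in\mathcal{U}$ with $U\subseteq\{0,1,2,3\}^d$ and $S^{(m)}_j\subseteq U$), $L:B\to[i]$ is any labelling of the bow $B=\{01,20,03,22\}$, and $h\in\{1,2\}$, then the set $T_h(B,L)\subseteq\{0,1,2,3\}^{d+1}$ obtained by applying the rule to the bow belongs to $\mathcal{U}$. Then for every $n\ge 1$, every $n$-dimensional USO (as a set of strings in $\{0,1,2,3\}^n$) belongs to $\mathcal{U}$. In other words, every USO of dimension $n\ge1$ can be generated from the two $1$-dimensional USOs by repeated application of generalized rewriting rules to the bow, where the sets used in each rule are partial orientations taken from already obtained USOs.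
   Context: Hypercubes and USOs. $[k]=\{1,\ldots,k\}$. $Q_k$ is the $k$-dimensional hypercube graph with vertex set $\{0,1\}^k$; $v\oplus i$ denotes the neighbor of $v$ differing from $v$ exactly in coordinate $i$, and $\{v,v\oplus i\}$ is an $i$-edge. An orientation $O$ of $Q_k$ directs every edge; it is identified with the function $O:\{0,1\}^k\to\{0,1\}^k$ where $O(v)_i=1$ if the edge $\{v,v\oplus i\}$ is directed upwards (from its endpoint with $i$-th coordinate $0$ to its endpoint with $i$-th coordinate $1$) and $O(v)_i=0$ if it is directed downwards (so $O(v)_i=O(v\oplus i)_i$). A face is the subgraph induced by all vertices that agree with a fixed string $f\in\{0,1,*\}^k$ on the non-$*$ positions. $O$ is a Unique Sink Orientation (USO) if every face contains exactly one vertex with no outgoing edges inside that face. String encoding. An orientation $O$ of $Q_k$ is encoded as the set of $2^k$ strings $\{p(v): v\in\{0,1\}^k\}\subseteq\{0,1,2,3\}^k$ with $p(v)_i=2v_i+O(v)_i$. A set $K\subseteq\{0,1,2,3\}^k$ is said to be (or define) a $k$-dimensional USO if it is the encoding of some USO of $Q_k$. A partial orientation of a USO corresponds to a subset of its set of strings (possibly empty). Generalized rewriting rule. For $i\ge1$, a generalized rewriting rule consists of sets $S^{(m)}_j\subseteq\{0,1,2,3\}^d$ ($m\in\{0,1,2,3\}$, $j\in[i]$) such that for all $j,j'\in[i]$: (i) $S^{(0)}_j\cap S^{(2)}_{j'}=\emptyset$ and $S^{(0)}_j\cup S^{(2)}_{j'}$ defines a $d$-dimensional USO; (ii) $S^{(1)}_j\cap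 S^{(3)}_{j'}=\emptyset$ and $S^{(1)}_j\cup S^{(3)}_{j'}$ defines a $d$-dimensional USO. For $K\subseteq\{0,1,2,3\}^k$, a labelling $L:K\to[i]$ and $h\in[k]$, applying the rule to $K$ on dimension $h$ gives $$T_h(K,L)=\bigcup_{v\in K}\left\{v_1\cdots v_{h-1}\,t_1\cdots t_d\,v_{h+1}\cdots v_k \;\middle|\; t\in S^{(v_h)}_{L(v)}\right\}\subseteq\{0,1,2,3\}^{k+d-1}.$$ *)

theory Defs
  imports Main
begin

(* Coordinates of strings and vertices are list positions, hence counted from 0. *)

definition cube :: "nat \<Rightarrow> bool list set" where
  "cube k = {v. length v = k}"

definition flip :: "bool list \<Rightarrow> nat \<Rightarrow> bool list" where
  "flip v i = v[i := \<not> v ! i]"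

(* "w v ! i" is True iff the edge between v and "flip v i" is directed upwards, i.e. from
   its endpoint with i-th coordinate False to its endpoint with i-th coordinate True. *)
definition orientation :: "nat \<Rightarrow> (bool list \<Rightarrow> bool list) \<Rightarrow> bool" where
  "orientation k w \<longleftrightarrow>
     (\<forall>v\<in>cube k. w v \<in> cube k \<and> (\<forall>i<k. w v ! i = w (flip v i) ! i))"

(* The edge is outgoing at its lower endpoint iff it is directed upwards, and at its upper
   endpoint iff it is directed downwards. *)
definition outgoing :: "(bool list \<Rightarrow> bool list) \<Rightarrow> bool list \<Rightarrow> nat \<Rightarrow> bool" where
  "outgoing w v i \<longleftrightarrow> (\<not> v ! i \<and> w v ! i) \<or> (v ! i \<and> \<not> w v ! i)"

(* A face is given by a string over {0,1,*}; None stands for *. *)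
definition face :: "bool option list \<Rightarrow> bool list set" where
  "face f = {v \<in> cube (length f). \<forall>i<length f. \<forall>b. f ! i = Some b \<longrightarrow> v ! i = b}"

definition sink_in_face :: "(bool list \<Rightarrow> bool list) \<Rightarrow> bool option list \<Rightarrow> bool list \<Rightarrow> bool" where
  "sink_in_face w f v \<longleftrightarrow>
     v \<in> face f \<and> (\<forall>i<length f. f ! i = None \<longrightarrow> \<not> outgoing w v i)"

definition unique_sink_orientation :: "nat \<Rightarrow> (bool list \<Rightarrow> bool list) \<Rightarrow> bool" where
  "unique_sink_orientation k w \<longleftrightarrow>
     orientation k w \<and> (\<forall>f. length f = k \<longrightarrow> (\<exists>!v. sink_in_face w f v))"

definition strings :: "nat \<Rightarrow> nat list set" where
  "strings k = {s. length s = k \<and> set s \<subseteq> {0, 1, 2, 3}}"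

definition vertex_string :: "nat \<Rightarrow> (bool list \<Rightarrow> bool list) \<Rightarrow> bool list \<Rightarrow> nat list" where
  "vertex_string k w v = map (\<lambda>i. 2 * of_bool (v ! i) + of_bool (w v ! i)) [0..<k]"

definition encoding :: "nat \<Rightarrow> (bool list \<Rightarrow> bool list) \<Rightarrow> nat list set" where
  "encoding k w = vertex_string k w ` cube k"

definition is_USO :: "nat \<Rightarrow> nat list set \<Rightarrow> bool" where
  "is_USO k K \<longleftrightarrow> (\<exists>w. unique_sink_orientation k w \<and> K = encoding k w)"

(* "S m j" is the replacement set for the symbol m under the label j. *)
definition generalized_rule :: "nat \<Rightarrow> nat \<Rightarrow> (nat \<Rightarrow> nat \<Rightarrow> nat list set) \<Rightarrow> bool" where
  "generalized_rule d l S \<longleftrightarrow>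
     l \<ge> 1 \<and>
     (\<forall>m\<in>{0, 1, 2, 3}. \<forall>j\<in>{1..l}. S m j \<subseteq> strings d) \<and>
     (\<forall>j\<in>{1..l}. \<forall>j'\<in>{1..l}.
        S 0 j \<inter> S 2 j' = {} \<and> is_USO d (S 0 j \<union> S 2 j') \<and>
        S 1 j \<inter> S 3 j' = {} \<and> is_USO d (S 1 j \<union> S 3 j'))"

(* The dimension h is counted from 1, so the replaced symbol is "v ! (h - 1)". *)
definition apply_rule ::
  "(nat \<Rightarrow> nat \<Rightarrow> nat list set) \<Rightarrow> nat \<Rightarrow> nat list set \<Rightarrow> (nat list \<Rightarrow> nat) \<Rightarrow> nat list set" where
  "apply_rule S h K L =
     (\<Union>v\<in>K. {take (h - 1) v @ t @ drop h v | t. t \<in> S (v ! (h - 1)) (L v)})"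

definition bow :: "nat list set" where
  "bow = {[0, 1], [2, 0], [0, 3], [2, 2]}"

inductive_set generated :: "nat list set set" where
  base_down: "{[0], [2]} \<in> generated"
| base_up: "{[1], [3]} \<in> generated"
| rewrite: "\<lbrakk>d \<ge> 1; l \<ge> 1; generalized_rule d l S;
     \<forall>m\<in>{0, 1, 2, 3}. \<forall>j\<in>{1..l}. \<exists>U. U \<in> generated \<and> U \<subseteq> strings d \<and> S m j \<subseteq> U;
     \<forall>v\<in>bow. L v \<in> {1..l}; h \<in> {1, 2}\<rbrakk>
   \<Longrightarrow> apply_rule S h bow L \<in> generated"

end

theory Submission
  imports Defs
begin

text \<open>
  An orientation is a USO iff any two distinct vertices differ in some coordinate in which the
  orientation has the same direction at both (Szabo and Welzl). Split an (n+1)-dimensional USO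
  along its last coordinate into its lower facet A and upper facet B, and let V be the set of
  vertices at which the last coordinate is directed upwards. For x in V and y outside V, the
  vertices x of A and y of B differ in the last coordinate but the directions there differ too, so
  the coordinate promised by the criterion is one of the first n. Hence every mixture
  that takes either A or B on V, and either A or B off V, is again a USO. The
  restrictions of A and B to V and to its complement therefore form a generalized rewriting rule,
  and applying it to the first dimension of the bow gives back the USO, since the first symbol of
  the bow is always 0 or 2 while the second one runs through all four symbols.
\<close>

section \<open>The Szabo-Welzl criterion\<close>

lemma finite_cube: "finite (cube k)"
  using finite_lists_length_eq[of "UNIV :: bool set" k] by (simp add: cube_def)

lemma face_update:
  assumes "i < length f" "f ! i = None"
  shows "v \<in> face (f[i := Some b]) \<longleftrightarrow> v \<in> face f \<and> v ! i = b"
  using assms by (auto simp: face_def cube_def nth_list_update)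

text \<open>Induction on \<open>R\<close>, the case of no outgoing edges being the unique sink. To
  insert a free coordinate \<open>i\<close>, cut the face across \<open>i\<close>. Each half has one
  vertex whose outgoing edges match \<open>R\<close> off \<open>i\<close>; exactly one of these two
  matches \<open>R\<close> at \<open>i\<close> as well, so the other matches
  \<open>insert i R\<close>.\<close>

lemma outmap_bijective_on_face:
  assumes "unique_sink_orientation k w" "finite R" "length f = k"
  shows "\<exists>!v. v \<in> face f \<and> (\<forall>i<k. f ! i = None \<longrightarrow> outgoing w v i = (i \<in> R))"
  using assms(2,3)
proof (induction R arbitrary: f rule: finite_induct)
  case empty
  then show ?case
    using assms(1) by (simp add: unique_sink_orientation_def sink_in_face_def)
next
  case (insert i R)
  define P where "P R f v \<longleftrightarrow> v \<in> face f \<and> (\<forall>i<k. f ! i = None \<longrightarrow> outgoing w v i = (i \<in> R))"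
    for R f v
  have IH: "\<exists>!v. P R g v" if "length g = k" for g
    using insert.IH[OF that] by (simp add: P_def)
  have "\<exists>!v. P (insert i R) f v"
  proof (cases "i < k \<and> f ! i = None")
    case False
    then have "P (insert i R) f = P R f"
      by (auto simp: P_def fun_eq_iff)
    then show ?thesis
      using IH insert.prems by simp
  next
    case True
    have split: "P R (f[i := Some b]) v \<longleftrightarrow>
        v ! i = b \<and> (P R f v \<or> P (insert i R) f v)" for b v
    proof -
      have "P R (f[i := Some b]) v \<longleftrightarrow> v \<in> face f \<and> v ! i = b \<and>
          (\<forall>j<k. j \<noteq> i \<longrightarrow> f ! j = None \<longrightarrow> outgoing w v j = (j \<in> R))"
        using True insert.prems by (auto simp: P_def face_update nth_list_update)
      then show ?thesis
        using True insert.hyps(2) unfolding P_def by blast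
    qed
    have excl: "\<not> (P R f v \<and> P (insert i R) f v)" for v
      using True insert.hyps(2) unfolding P_def by blast
    have half: "\<exists>!v. v ! i = b \<and> (P R f v \<or> P (insert i R) f v)" for b
      using IH[of "f[i := Some b]"] insert.prems by (simp add: split)
    obtain u where u: "P R f u" "\<And>v. P R f v \<Longrightarrow> v = u"
      using IH insert.prems by blast
    obtain u' where u': "u' ! i = (\<not> u ! i)" "P R f u' \<or> P (insert i R) f u'"
      using half by blast
    then have "P (insert i R) f u'"
      using u(2) by blast
    moreover have "v = u'" if "P (insert i R) f v" for v
    proof (cases "v ! i = u ! i")
      case True
      then have "v = u"
        using half[of "u ! i"] u(1) that by blast
      then show ?thesis
        using that u(1) excl by blast
    next
      case False
      then show ?thesis
        using half[of "\<not> u ! i"] u' that by blast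
    qed
    ultimately show ?thesis
      by blast
  qed
  then show ?case
    by (simp only: P_def)
qed

text \<open>If every differing coordinate had opposite directions at \<open>x\<close> and
  \<open>y\<close>, both would have the same outgoing edges in the smallest face containing
  them.\<close>

lemma USO_separates:
  assumes "unique_sink_orientation k w" "x \<in> cube k" "y \<in> cube k" "x \<noteq> y"
  shows "\<exists>i<k. x ! i \<noteq> y ! i \<and> w x ! i = w y ! i"
proof (rule ccontr)
  assume contra: "\<not> ?thesis"
  \<comment> \<open>This is the smallest face containing \<open>x\<close> and \<open>y\<close>: its
    free coordinates are those where they differ.\<close>
  define f where "f = map (\<lambda>i. if x ! i = y ! i then Some (x ! i) else None) [0..<k]"
  define R where "R = {i. i < k \<and> outgoing w x i}"
  have "x \<in> face f" "y \<in> face f"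
    using assms(2,3) by (auto simp: face_def f_def cube_def split: if_splits)
  moreover have "\<forall>i<k. f ! i = None \<longrightarrow> outgoing w x i = (i \<in> R)"
    by (simp add: R_def)
  moreover have "\<forall>i<k. f ! i = None \<longrightarrow> outgoing w y i = (i \<in> R)"
    using contra by (auto simp: R_def f_def outgoing_def split: if_splits)
  moreover have "length f = k" "finite R"
    by (simp_all add: f_def R_def)
  ultimately show False
    using outmap_bijective_on_face[OF assms(1)] assms(4) by blast
qed

text \<open>Inside a face, the criterion says that distinct vertices have distinct sets of outgoing
  edges. By counting, every set of free coordinates then occurs, in particular the empty
  one.\<close>

lemma separates_USO:
  assumes into: "\<And>v. v \<in> cube k \<Longrightarrow> w v \<in> cube k"
    and sep: "\<And>x y. \<lbrakk>x \<in> cube k; y \<in> cube k; x \<noteq> y\<rbrakk> \<Longrightarrow> \<exists>i<k. x ! i \<noteq> y ! i \<and> w x ! i = w y ! i"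
  shows "unique_sink_orientation k w"
  unfolding unique_sink_orientation_def
proof (intro conjI allI impI)
  show "orientation k w"
    unfolding orientation_def
  proof (intro ballI conjI allI impI)
    fix v i assume v: "v \<in> cube k" "i < k"
    then have "flip v i \<in> cube k" "flip v i \<noteq> v"
      by (auto simp: flip_def cube_def list_eq_iff_nth_eq)
    \<comment> \<open>Neighbours differ in one coordinate only, so the criterion can only name that
      one.\<close>
    then obtain j where "j < k" "v ! j \<noteq> flip v i ! j" "w v ! j = w (flip v i) ! j"
      using sep[of v "flip v i"] v by auto
    moreover from this have "j = i"
      by (metis flip_def nth_list_update_neq)
    ultimately show "w v ! i = w (flip v i) ! i"
      by simp
  qed (use into in auto)
next
  fix f :: "bool option list" assume f: "length f = k"
  have face_cube: "face f \<subseteq> cube k"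
    using f by (auto simp: face_def)
  have inj: "x = y" if xy: "x \<in> face f" "y \<in> face f"
      and out: "\<And>i. \<lbrakk>i < k; f ! i = None\<rbrakk> \<Longrightarrow> outgoing w x i = outgoing w y i" for x y
  proof (rule ccontr)
    assume "x \<noteq> y"
    then obtain i where i: "i < k" "x ! i \<noteq> y ! i" "w x ! i = w y ! i"
      using sep xy face_cube by blast
    have "f ! i = None"
      using xy i(1,2) f by (cases "f ! i") (auto simp: face_def)
    then show False
      using out i by (auto simp: outgoing_def)
  qed
  \<comment> \<open>Encoding the outmap on the face as a map of the face into itself turns the counting
    argument for surjectivity into an application of the pigeonhole principle.\<close>
  define g where "g v = map (\<lambda>i. case f ! i of None \<Rightarrow> outgoing w v i | Some b \<Rightarrow> b) [0..<k]" for v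
  have "g ` face f = face f"
  proof (rule endo_inj_surj)
    show "finite (face f)"
      using face_cube finite_cube finite_subset by blast
    show "g ` face f \<subseteq> face f"
      using f by (auto simp: g_def face_def cube_def)
    show "inj_on g (face f)"
    proof (rule inj_onI)
      fix x y assume "x \<in> face f" "y \<in> face f" and eq: "g x = g y"
      moreover have "outgoing w x i = outgoing w y i" if "i < k" "f ! i = None" for i
        using arg_cong[OF eq, of "\<lambda>l. l ! i"] that by (simp add: g_def)
      ultimately show "x = y"
        using inj by blast
    qed
  qed
  \<comment> \<open>A preimage of \<open>?z\<close> under \<open>g\<close> has no outgoing edge
    along a free coordinate, so it is a sink.\<close>
  moreover have "map (\<lambda>i. case f ! i of None \<Rightarrow> False | Some b \<Rightarrow> b) [0..<k] \<in> face f" (is "?z \<in> _")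
    using f by (auto simp: face_def cube_def)
  ultimately obtain v where v: "v \<in> face f" "g v = ?z"
    by (metis (no_types, lifting) imageE)
  have "\<not> outgoing w v i" if "i < k" "f ! i = None" for i
    using arg_cong[OF v(2), of "\<lambda>l. l ! i"] that by (simp add: g_def)
  then have "sink_in_face w f v"
    using v(1) f by (simp add: sink_in_face_def)
  moreover have "u = v" if "sink_in_face w f u" for u
    using inj[of u v] that \<open>sink_in_face w f v\<close> f by (auto simp: sink_in_face_def)
  ultimately show "\<exists>!v. sink_in_face w f v"
    by blast
qed

section \<open>Facets along the last coordinate and their mixtures\<close>

lemma cube_Suc: "cube (Suc d) = {x @ [b] | x b. x \<in> cube d}"
proof (rule set_eqI)
  fix v :: "bool list"
  show "v \<in> cube (Suc d) \<longleftrightarrow> v \<in> {x @ [b] | x b. x \<in> cube d}"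
    by (cases v rule: rev_cases) (auto simp: cube_def)
qed

definition facet_orientation :: "nat \<Rightarrow> (bool list \<Rightarrow> bool list) \<Rightarrow> bool \<Rightarrow> bool list \<Rightarrow> bool list" where
  "facet_orientation d w b x = take d (w (x @ [b]))"

text \<open>The direction is read at the lower endpoint; in an orientation the upper endpoint gives
  the same value.\<close>

definition ascends :: "nat \<Rightarrow> (bool list \<Rightarrow> bool list) \<Rightarrow> bool list \<Rightarrow> bool" where
  "ascends d w x \<longleftrightarrow> w (x @ [False]) ! d"

lemma orientation_last_coordinate:
  assumes "orientation (Suc d) w" "x \<in> cube d"
  shows "w (x @ [b]) ! d \<longleftrightarrow> ascends d w x"
proof -
  have "x @ [True] \<in> cube (Suc d)" "flip (x @ [True]) d = x @ [False]"
    using assms(2) by (auto simp: cube_def flip_def)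
  then have "w (x @ [True]) ! d = w (x @ [False]) ! d"
    using assms(1) by (metis lessI orientation_def)
  then show ?thesis
    by (cases b) (simp_all add: ascends_def)
qed

lemma mixed_facets_USO:
  assumes USO: "unique_sink_orientation (Suc d) w"
  shows "unique_sink_orientation d
    (\<lambda>x. facet_orientation d w (if ascends d w x then b else b') x)" (is "unique_sink_orientation d ?u")
proof (rule separates_USO)
  have ori: "orientation (Suc d) w"
    using USO by (simp add: unique_sink_orientation_def)
  have len: "length (w (x @ [b])) = Suc d" if "x \<in> cube d" for x b
    using ori that by (force simp: orientation_def cube_def)
  show "?u x \<in> cube d" if "x \<in> cube d" for x
    using len that by (simp add: facet_orientation_def cube_def)
  fix x y :: "bool list" assume xy: "x \<in> cube d" "y \<in> cube d" "x \<noteq> y"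
  \<comment> \<open>\<open>c z\<close> is the facet that the mixture follows at \<open>z\<close>, so
    \<open>z @ [c z]\<close> lifts \<open>z\<close> to the larger cube.\<close>
  define c where "c z = (if ascends d w z then b else b')" for z
  have "x @ [c x] \<in> cube (Suc d)" "y @ [c y] \<in> cube (Suc d)" "x @ [c x] \<noteq> y @ [c y]"
    using xy by (auto simp: cube_def)
  then obtain i where i: "i < Suc d" "(x @ [c x]) ! i \<noteq> (y @ [c y]) ! i"
      "w (x @ [c x]) ! i = w (y @ [c y]) ! i"
    using USO_separates[OF USO] by blast
  \<comment> \<open>Equal directions along the last coordinate would make the mixture choose the
    same facet at \<open>x\<close> and \<open>y\<close>.\<close>
  have "i \<noteq> d"
  proof
    assume "i = d"
    then have "c x \<noteq> c y"
      using i(2) xy by (auto simp: cube_def nth_append)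
    moreover have "ascends d w x = ascends d w y"
      using i(3) \<open>i = d\<close> orientation_last_coordinate[OF ori] xy by blast
    ultimately show False
      by (simp add: c_def)
  qed
  then have "i < d"
    using i(1) by simp
  moreover from this have "x ! i \<noteq> y ! i"
    using i(2) xy by (simp add: cube_def nth_append)
  ultimately show "\<exists>i<d. x ! i \<noteq> y ! i \<and> ?u x ! i = ?u y ! i"
    using i(3) by (auto simp: facet_orientation_def c_def)
qed

lemma facet_USO:
  assumes "unique_sink_orientation (Suc d) w"
  shows "unique_sink_orientation d (facet_orientation d w b)"
  using mixed_facets_USO[OF assms, of b b] by simp

section \<open>String encodings of partial facets\<close>

lemma vertex_string_in_strings: "vertex_string d w x \<in> strings d"
  by (auto simp: vertex_string_def strings_def)

text \<open>Halving each symbol recovers the vertex whatever the orientation, so strings of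
  different vertices never clash even across the two facets.\<close>

lemma vertex_string_vertex_eq:
  assumes "vertex_string d w x = vertex_string d w' y" "x \<in> cube d" "y \<in> cube d"
  shows "x = y"
proof (rule nth_equalityI)
  fix i assume "i < length x"
  then have "(2 :: nat) * of_bool (x ! i) + of_bool (w x ! i) = 2 * of_bool (y ! i) + of_bool (w' y ! i)"
    using arg_cong[OF assms(1), of "\<lambda>l. l ! i"] assms(2) by (simp add: vertex_string_def cube_def)
  then show "x ! i = y ! i"
    by (auto simp: of_bool_def split: if_splits)
qed (use assms in \<open>simp add: cube_def\<close>)

lemma vertex_string_cong:
  assumes "w x = w' x"
  shows "vertex_string d w x = vertex_string d w' x"
  using assms by (simp add: vertex_string_def)

lemma vertex_string_snoc:
  assumes "x \<in> cube d"
  shows "vertex_string (Suc d) w (x @ [b]) =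
    vertex_string d (facet_orientation d w b) x @ [2 * of_bool b + of_bool (w (x @ [b]) ! d)]"
  using assms by (simp add: vertex_string_def cube_def nth_append facet_orientation_def)

definition partial_facet :: "nat \<Rightarrow> (bool list \<Rightarrow> bool list) \<Rightarrow> bool \<Rightarrow> bool \<Rightarrow> nat list set" where
  "partial_facet d w up b =
     vertex_string d (facet_orientation d w b) ` {x \<in> cube d. ascends d w x = up}"

lemma partial_facet_union:
  "partial_facet d w True b \<union> partial_facet d w False b' =
    encoding d (\<lambda>x. facet_orientation d w (if ascends d w x then b else b') x)" (is "_ = encoding d ?u")
proof -
  have "partial_facet d w True b = vertex_string d ?u ` {x \<in> cube d. ascends d w x}"
    unfolding partial_facet_def by (rule image_cong) (auto intro: vertex_string_cong)
  moreover have "partial_facet d w False b' = vertex_string d ?u ` {x \<in> cube d. \<not> ascends d w x}"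
    unfolding partial_facet_def by (rule image_cong) (auto intro: vertex_string_cong)
  moreover have "cube d = {x \<in> cube d. ascends d w x} \<union> {x \<in> cube d. \<not> ascends d w x}"
    by blast
  ultimately show ?thesis
    unfolding encoding_def by (metis (no_types, lifting) image_Un)
qed

lemma partial_facet_disjoint: "partial_facet d w True b \<inter> partial_facet d w False b' = {}"
  by (auto simp: partial_facet_def dest: vertex_string_vertex_eq)

lemma partial_facet_subset: "partial_facet d w up b \<subseteq> encoding d (facet_orientation d w b)"
  by (auto simp: partial_facet_def encoding_def)

text \<open>The label of a bow vertex selects the facet: 1 for the lower and 2 for the upper one.\<close>

definition facet_rule :: "nat \<Rightarrow> (bool list \<Rightarrow> bool list) \<Rightarrow> nat \<Rightarrow> nat \<Rightarrow> nat list set" where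
  "facet_rule d w m j = partial_facet d w (m < 2) (j = 2)"

definition facet_label :: "nat list \<Rightarrow> nat" where
  "facet_label v = (if v ! 1 < 2 then 1 else 2)"

text \<open>Symbols 0 and 1 share their replacement sets, as do 2 and 3, so both rule conditions
  reduce to the same statement on mixtures, with the two labels as free choices of facet.\<close>

lemma facet_rule_generalized:
  assumes "unique_sink_orientation (Suc d) w"
  shows "generalized_rule d 2 (facet_rule d w)"
proof -
  have "is_USO d (partial_facet d w True b \<union> partial_facet d w False b')" for b b'
    using mixed_facets_USO[OF assms] unfolding is_USO_def partial_facet_union by blast
  moreover have "partial_facet d w up b \<subseteq> strings d" for up b
    using vertex_string_in_strings by (auto simp: partial_facet_def)
  ultimately show ?thesis
    by (simp add: generalized_rule_def facet_rule_def partial_facet_disjoint)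
qed

text \<open>The second bow symbol survives as the last symbol of each new string. In 01, 20, 03, 22
  it equals \<open>2 * of_bool b + of_bool up\<close> for the facet \<open>b\<close> and direction
  \<open>up\<close> selected there, which is the symbol that the last coordinate requires.\<close>

lemma apply_facet_rule:
  assumes "orientation (Suc d) w"
  shows "apply_rule (facet_rule d w) 1 bow facet_label = encoding (Suc d) w"
proof -
  define glue where "glue up b = (\<lambda>t. t @ [2 * of_bool b + of_bool up]) ` partial_facet d w up b"
    for up b
  have "apply_rule (facet_rule d w) 1 bow facet_label =
      glue True False \<union> glue False False \<union> glue True True \<union> glue False True"
    by (auto simp: apply_rule_def bow_def facet_rule_def facet_label_def glue_def)
  also have "\<dots> = (\<Union>up b. glue up b)"
    by (auto simp: UNIV_bool)
  also have "\<dots> = encoding (Suc d) w"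
  proof -
    have "glue up b = (\<lambda>x. vertex_string (Suc d) w (x @ [b])) ` {x \<in> cube d. ascends d w x = up}"
      for up b
      unfolding glue_def partial_facet_def image_image
      by (rule image_cong) (auto simp: vertex_string_snoc orientation_last_coordinate[OF assms])
    then show ?thesis
      by (auto simp: encoding_def cube_Suc)
  qed
  finally show ?thesis .
qed

lemma USO_1_generated:
  assumes "is_USO 1 K"
  shows "K \<in> generated"
proof -
  obtain w where w: "unique_sink_orientation (Suc 0) w" "K = encoding (Suc 0) w"
    using assms by (auto simp: is_USO_def)
  have "orientation (Suc 0) w"
    using w(1) by (simp add: unique_sink_orientation_def)
  \<comment> \<open>The only edge of the 1-cube lies over the empty vertex, so its direction alone
    determines \<open>K\<close>.\<close>
  then have "w [b] ! 0 \<longleftrightarrow> ascends 0 w []" for b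
    using orientation_last_coordinate[of 0 w "[]" b] by (simp add: cube_def)
  moreover have "cube (Suc 0) = {[False], [True]}"
    by (auto simp: cube_def length_Suc_conv)
  ultimately have "K = {[of_bool (ascends 0 w [])], [2 + of_bool (ascends 0 w [])]}"
    by (simp add: w(2) encoding_def vertex_string_def)
  then show ?thesis
    using base_down base_up by (cases "ascends 0 w []") (simp_all add: numeral_eq_Suc)
qed

theorem theorem24:
  fixes n :: nat and K :: "nat list set"
  assumes "n \<ge> 1"
    and "is_USO n K"
  shows "K \<in> generated"
  using assms
proof (induction n arbitrary: K rule: nat_induct_at_least)
  case base
  then show ?case
    by (rule USO_1_generated)
next
  case (Suc d)
  obtain w where w: "unique_sink_orientation (Suc d) w" "K = encoding (Suc d) w"
    using Suc.prems by (auto simp: is_USO_def)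
  \<comment> \<open>By induction the two facets are available as the USOs from which the rule takes
    its partial orientations.\<close>
  have facet: "encoding d (facet_orientation d w b) \<in> generated" for b
    using Suc.IH facet_USO[OF w(1)] by (auto simp: is_USO_def)
  have in_strings: "encoding d u \<subseteq> strings d" for u
    using vertex_string_in_strings by (auto simp: encoding_def)
  have "apply_rule (facet_rule d w) 1 bow facet_label \<in> generated"
  proof (rule rewrite)
    show "d \<ge> 1"
      by (fact Suc.hyps)
    show "generalized_rule d 2 (facet_rule d w)"
      by (rule facet_rule_generalized[OF w(1)])
    show "\<forall>m\<in>{0, 1, 2, 3}. \<forall>j\<in>{1..2}. \<exists>U. U \<in> generated \<and> U \<subseteq> strings d \<and> facet_rule d w m j \<subseteq> U"
      unfolding facet_rule_def using facet in_strings partial_facet_subset by blast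
  qed (auto simp: facet_label_def)
  then show ?case
    using apply_facet_rule w by (simp add: unique_sink_orientation_def)
qed

end
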